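(* Let $1\le r\le n$ be integers, let $\mathcal{P},\mathcal{N}$ be disjoint subsets of $\{1,\dots,r\}$, and let $S$ and $\mathbb{S}^{n,r}_S$ be the associated sign matrix and sign-constrained Stiefel manifold. For any matrix $X\in\mathbb{R}^{n\times r}$, $$\operatorname{dist}(X,\mathbb{S}^{n,r}_S)\;\le\;15\,r^{3/4}\left(\|(S\circ X)_-\|_F^{1/2}+\|X^{T}X-I_r\|_F^{1/2}\right).$$ Moreover, if $\|(S\circ X)_-\|_F+\|X^{T}X-I_r\|_F<1/(3\sqrt r)$, then $$\operatorname{dist}(X,\mathbb{S}^{n,r}_S)\;\le\;15\sqrt r\left(\|(S\circ X)_-\|_F^{1/2}+\|X^{T}X-I_r\|_F^{1/2}\right).$$
   Context: The sign matrix $S\in\mathbb{R}^{n\times r}$ is defined by $S_{i,j}=1$ if $j\in\mathcal{P}$, $S_{i,j}=-1$ if $j\in\mathcal{N}$, and $S_{i,j}=0$ otherwise ($1\le i\le n$). $\circ$ is the Hadamard (entry-wise) product. The sign-constrained Stiefel manifold is $\mathbb{S}^{n,r}_S=\{X\in\mathbb{R}^{n\times r}: S\circ X\ge 0,\ X^{T}X=I_r\}$, where $\ge$ is entry-wise and $I_r$ is the $r\times r$ identity. For a matrix $Y$, $Y_-=\max\{-Y,0\}$ entry-wise. $\|\cdot\|_F$ is the Frobenius norm and $\operatorname{dist}(X,\mathcal{T})$ is the distance from $X$ to the set $\mathcal{T}\subset\mathbb{R}^{n\times r}$ in the Frobenius norm. *)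

theory Defs
  imports "HOL-Analysis.Analysis"
begin

text \<open>
  An \<open>n \<times> r\<close> real matrix is an element of \<^typ>\<open>real^'r^'n\<close>, and \<open>X $ i $ j\<close> is its entry in
  row \<open>i\<close> and column \<open>j\<close>. The integers \<open>n\<close> and \<open>r\<close> are \<open>CARD('n)\<close> and \<open>CARD('r)\<close>, both of which
  are at least 1. The order on matrices is entry-wise, and the norm (with its distance) is the
  Frobenius norm, as the following two lemmas show.
\<close>

lemma matrix_le_iff:
  fixes A B :: "real^'r^'n"
  shows "A \<le> B \<longleftrightarrow> (\<forall>i j. A $ i $ j \<le> B $ i $ j)"
  by (simp add: less_eq_vec_def)

lemma norm_matrix_eq_frobenius:
  fixes A :: "real^'r^'n"
  shows "norm A = sqrt (\<Sum>i\<in>UNIV. \<Sum>j\<in>UNIV. (A $ i $ j)\<^sup>2)"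
  by (simp add: norm_vec_def L2_set_def sum_nonneg)

definition hadamard :: "real^'r^'n \<Rightarrow> real^'r^'n \<Rightarrow> real^'r^'n" where
  "hadamard A B = (\<chi> i j. A $ i $ j * B $ i $ j)"

definition neg_part :: "real^'r^'n \<Rightarrow> real^'r^'n" where
  "neg_part Y = (\<chi> i j. max (- (Y $ i $ j)) 0)"

text \<open>
  The columns of the sign matrix are constant, so the row index type \<open>'n\<close> occurs only in the
  result type.
\<close>

definition sign_matrix :: "'r set \<Rightarrow> 'r set \<Rightarrow> real^'r^'n" where
  "sign_matrix P N = (\<chi> i j. if j \<in> P then 1 else if j \<in> N then -1 else 0)"

definition sign_stiefel :: "real^'r^'n \<Rightarrow> (real^'r^'n) set" where
  "sign_stiefel S = {X. hadamard S X \<ge> 0 \<and> transpose X ** X = mat 1}"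

text \<open>
  By convention \<open>infdist x {} = 0\<close>. The next lemma shows that this case does not arise when
  \<open>r \<le> n\<close>, so \<open>infdist X (sign_stiefel S)\<close> is then the infimum of the Frobenius distances.
\<close>

lemma sign_stiefel_nonempty:
  assumes "CARD('r::finite) \<le> CARD('n::finite)" and "P \<inter> N = {}"
  shows "sign_stiefel (sign_matrix P N :: real^'r^'n) \<noteq> {}"
proof -
  obtain f :: "'r \<Rightarrow> 'n" where f: "inj f"
    using card_le_inj[OF finite finite assms(1)] by blast
  define e :: "'r \<Rightarrow> real" where "e j = (if j \<in> N then -1 else 1)" for j
  define X :: "real^'r^'n" where "X = (\<chi> i j. if i = f j then e j else 0)"
  have "(transpose X ** X) $ j $ k = (mat 1 :: real^'r^'r) $ j $ k" for j k
  proof -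
    have "(transpose X ** X) $ j $ k = (\<Sum>i\<in>UNIV. X $ i $ j * X $ i $ k)"
      by (simp add: matrix_matrix_mult_def transpose_def)
    also have "\<dots> = (\<Sum>i\<in>UNIV. if i = f j then e j * X $ i $ k else 0)"
      by (rule sum.cong) (simp_all add: X_def)
    also have "\<dots> = e j * X $ f j $ k"
      by simp
    also have "\<dots> = (mat 1 :: real^'r^'r) $ j $ k"
      using f by (auto simp: X_def mat_def e_def inj_eq)
    finally show ?thesis .
  qed
  then have "transpose X ** X = mat 1"
    by (simp add: vec_eq_iff)
  moreover have "hadamard (sign_matrix P N) X \<ge> 0"
    using assms(2) by (auto simp: matrix_le_iff hadamard_def sign_matrix_def X_def e_def)
  ultimately show ?thesis
    by (auto simp: sign_stiefel_def)
qed

end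

theory Submission
  imports Defs
begin

text \<open>
  Flipping the columns in \<open>N\<close> reduces everything to matrices whose columns in \<open>C = P \<union> N\<close> should be
  nonnegative. Let \<open>a\<close> be the norm of the sign violation, \<open>b\<close> the Gram defect, that is, the norm of
  \<open>X\<^sup>T X - I\<close>, and suppose first that \<open>a + b < 1 / (3 sqrt r)\<close>. A matrix of the manifold close to \<open>X\<close> is
  constructed in three steps.

  Entries of the wrong sign are set to zero. This moves \<open>X\<close> by \<open>a\<close> and gives a matrix \<open>Y\<close> whose Gram
  defect \<open>\<beta>\<close> is of order \<open>a + b\<close> (\<open>gram_perturbation\<close>).

  The columns of \<open>Y\<close> in \<open>C\<close> are rounded to orthonormal nonnegative columns \<open>W\<close>
  (\<open>round_nonnegative_columns\<close>). Orthogonality of nonnegative vectors means disjointness of supports,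
  so only the largest entry of every row survives. The mass that is lost is bounded by the
  off-diagonal entries of the Gram matrix. Their absolute sum is at most \<open>r \<beta>\<close>, so that the
  error is of order \<open>sqrt (r \<beta>)\<close>. This is where both the square root of the residual and the factor
  \<open>sqrt r\<close> come from.

  The remaining columns are projected onto the orthogonal complement of \<open>W\<close> and replaced there by the
  polar factor of the result (\<open>nearby_sign_frame\<close>, \<open>nearby_partial_isometry\<close>). The projection moves
  them by no more than the order of the rounding error. The polar factor comes from a singular value
  decomposition of a linear map between two subspaces, which is obtained by repeatedly splitting off
  a direction of maximal stretch (\<open>singular_value_decomposition\<close>); the complement of \<open>W\<close> has enough
  room for it because \<open>r \<le> n\<close>.

  If \<open>a + b \<ge> 1 / (3 sqrt r)\<close>, then \<open>r powr (3/4) * (sqrt a + sqrt b)\<close> is at least of order \<open>sqrt r\<close>, and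
  the trivial estimate of the distance by the norm of \<open>X\<close> plus \<open>sqrt r\<close> suffices
  (\<open>crude_distance_bound\<close>). This explains the larger power of \<open>r\<close> in the global bound.
\<close>

section \<open>Singular values of a map between subspaces\<close>

lemma dim_orthogonal_complement_vector:
  fixes v :: "'a::euclidean_space"
  assumes T: "subspace T" and v: "v \<in> T" "v \<noteq> 0"
  shows "dim {w \<in> T. v \<bullet> w = 0} + 1 = dim T"
proof -
  have eq: "{w \<in> T. v \<bullet> w = 0} = {w \<in> T. \<forall>x \<in> span {v}. orthogonal x w}"
    by (auto simp: span_singleton orthogonal_def)
  have "span {v} \<subseteq> T"
    using T v by (simp add: span_minimal)
  then have "dim {w \<in> T. v \<bullet> w = 0} + dim (span {v}) = dim T"
    unfolding eq using T by (intro dim_subspace_orthogonal_to_vectors) auto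
  moreover have "dim (span {v}) = 1"
    using v by (simp add: dim_span dim_insert)
  ultimately show ?thesis by simp
qed

lemma linear_term_zero:
  fixes p q :: real
  assumes "\<And>t. 2 * t * p \<le> t\<^sup>2 * q"
  shows "p = 0"
proof (rule ccontr)
  assume "p \<noteq> 0"
  define s where "s = \<bar>q\<bar> + 1"
  have "s > 0" "q < s" by (auto simp: s_def)
  from assms[of "p / s"] have "2 * (p\<^sup>2 / s) \<le> (p\<^sup>2 / s) * (q / s)"
    using \<open>s > 0\<close> by (simp add: power2_eq_square)
  moreover have "p\<^sup>2 / s > 0" using \<open>p \<noteq> 0\<close> \<open>s > 0\<close> by simp
  ultimately have "2 \<le> q / s" by (metis mult.commute mult_le_cancel_left_pos)
  then show False using \<open>s > 0\<close> \<open>q < s\<close> by (simp add: field_simps)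
qed

text \<open>
  First-order optimality: moving the maximiser \<open>v\<close> to \<open>v + t w\<close> with \<open>w\<close> orthogonal to \<open>v\<close> changes
  the squared length of the argument only at order \<open>t\<^sup>2\<close>, so the first-order change
  \<open>2 t (A v \<bullet> A w)\<close> of the squared length of the image has to vanish.
\<close>

lemma maximal_stretch_orthogonal:
  fixes A :: "'a::euclidean_space \<Rightarrow> 'b::euclidean_space"
  assumes A: "linear A" and T: "subspace T" "T \<noteq> {0}"
  obtains v where "v \<in> T" "norm v = 1" "\<And>x. x \<in> T \<Longrightarrow> norm (A x) \<le> norm (A v) * norm x"
    "\<And>w. w \<in> T \<Longrightarrow> v \<bullet> w = 0 \<Longrightarrow> A v \<bullet> A w = 0"
proof -
  interpret A: linear A by fact
  define K where "K = T \<inter> sphere 0 1"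
  have "compact K"
    unfolding K_def using T(1) by (intro closed_Int_compact closed_subspace) auto
  obtain x where x: "x \<in> T" "x \<noteq> 0" using T subspace_0 by blast
  then have "x /\<^sub>R norm x \<in> K" using T(1) by (simp add: K_def subspace_scale)
  then have "K \<noteq> {}" by blast
  moreover have "continuous_on K (\<lambda>x. norm (A x))"
    by (intro continuous_on_norm linear_continuous_on) (simp add: A linear_conv_bounded_linear[symmetric])
  ultimately obtain v where v: "v \<in> K" "\<And>y. y \<in> K \<Longrightarrow> norm (A y) \<le> norm (A v)"
    using continuous_attains_sup[OF \<open>compact K\<close>] by metis
  have v1: "v \<in> T" "norm v = 1" using v(1) by (auto simp: K_def)
  have max: "norm (A x) \<le> norm (A v) * norm x" if "x \<in> T" for x
  proof (cases "x = 0")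
    case False
    then have "x /\<^sub>R norm x \<in> K" using T(1) that by (simp add: K_def subspace_scale)
    from v(2)[OF this] False show ?thesis by (simp add: A.scaleR field_simps)
  qed (simp add: A.zero)
  have orth: "A v \<bullet> A w = 0" if w: "w \<in> T" "v \<bullet> w = 0" for w
  proof (rule linear_term_zero)
    fix t :: real
    have "v + t *\<^sub>R w \<in> T" using T(1) v1 w by (simp add: subspace_add subspace_scale)
    from max[OF this] have "(norm (A (v + t *\<^sub>R w)))\<^sup>2 \<le> (norm (A v) * norm (v + t *\<^sub>R w))\<^sup>2"
      by (intro power_mono) auto
    moreover have "(norm (v + t *\<^sub>R w))\<^sup>2 = 1 + t\<^sup>2 * (norm w)\<^sup>2"
      using w(2) v1(2)
      by (simp add: power2_norm_eq_inner inner_add_left inner_add_right inner_commute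
          power2_eq_square[of t] norm_eq_1)
    moreover have "(norm (A (v + t *\<^sub>R w)))\<^sup>2
        = (norm (A v))\<^sup>2 + 2 * t * (A v \<bullet> A w) + t\<^sup>2 * (norm (A w))\<^sup>2"
      by (simp add: A.add A.scaleR power2_norm_eq_inner inner_add_left inner_add_right inner_commute
          power2_eq_square[of t])
    ultimately show "2 * t * (A v \<bullet> A w) \<le> t\<^sup>2 * ((norm (A v))\<^sup>2 * (norm w)\<^sup>2)"
      by (simp add: power_mult_distrib algebra_simps) (smt (verit) mult_nonneg_nonneg zero_le_power2)
  qed
  show ?thesis using that v1 max orth by blast
qed

text \<open>
  The family is indexed, so that left and right singular vectors can share one index set; a set \<open>B\<close>
  of vectors is orthonormal when \<open>id\<close> is an orthonormal family on it.
\<close>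

definition orthonormal_family :: "('i \<Rightarrow> 'a::euclidean_space) \<Rightarrow> 'i set \<Rightarrow> bool" where
  "orthonormal_family u B \<longleftrightarrow> (\<forall>b\<in>B. \<forall>c\<in>B. u b \<bullet> u c = (if b = c then 1 else 0))"

text \<open>
  Split off a unit vector \<open>v\<close> that \<open>A\<close> stretches most, together with the direction \<open>a\<close> of \<open>A v\<close>. By
  \<open>maximal_stretch_orthogonal\<close> the map sends the orthogonal complement of \<open>v\<close> in \<open>T\<close> into the
  complement of \<open>a\<close> in \<open>U\<close>, and both dimensions drop by one. The hypothesis on the dimensions makes it
  possible to choose left singular vectors inside \<open>U\<close> even for the singular value zero. It is
  through this hypothesis that \<open>r \<le> n\<close> enters the construction of the approximating matrix.
\<close>

proposition singular_value_decomposition: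
  fixes A :: "'a::euclidean_space \<Rightarrow> 'b::euclidean_space"
  assumes A: "linear A" and "subspace T" "subspace U" "A ` T \<subseteq> U" "dim T \<le> dim U"
  shows "\<exists>B u. finite B \<and> B \<subseteq> T \<and> u ` B \<subseteq> U \<and> orthonormal_family id B \<and> orthonormal_family u B
     \<and> (\<forall>b\<in>B. A b = norm (A b) *\<^sub>R u b) \<and> (\<forall>x\<in>T. x = (\<Sum>b\<in>B. (x \<bullet> b) *\<^sub>R b))"
  using assms(2-)
proof (induction "dim T" arbitrary: T U)
  case 0
  then have "T \<subseteq> {0}" by (simp add: dim_eq_0)
  then show ?case
    by (intro exI[of _ "{}"]) (auto simp: orthonormal_family_def)
next
  case (Suc d)
  interpret A: linear A by fact
  have "T \<noteq> {0}" using Suc.hyps(2) by auto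
  then obtain v where v: "v \<in> T" "norm v = 1"
      and max: "\<And>x. x \<in> T \<Longrightarrow> norm (A x) \<le> norm (A v) * norm x"
      and orth: "\<And>w. w \<in> T \<Longrightarrow> v \<bullet> w = 0 \<Longrightarrow> A v \<bullet> A w = 0"
    using maximal_stretch_orthogonal[OF A Suc.prems(1)] by metis
  obtain a where a: "a \<in> U" "norm a = 1" "A v = norm (A v) *\<^sub>R a"
  proof (cases "A v = 0")
    case True
    \<comment> \<open>\<open>A\<close> vanishes on \<open>T\<close>, so any unit vector of \<open>U\<close> serves as left singular vector.\<close>
    have "dim U \<noteq> 0" using Suc.hyps(2) Suc.prems(4) by linarith
    then have "U \<noteq> {0}" by auto
    then obtain y where y: "y \<in> U" "y \<noteq> 0" using Suc.prems(2) subspace_0 by blast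
    show ?thesis
      by (rule that[of "y /\<^sub>R norm y"]) (use y True Suc.prems(2) in \<open>auto simp: subspace_scale\<close>)
  next
    case False
    show ?thesis
      by (rule that[of "A v /\<^sub>R norm (A v)"])
        (use v False Suc.prems(2,3) in \<open>auto simp: subspace_scale\<close>)
  qed
  define T' where "T' = {w \<in> T. v \<bullet> w = 0}"
  define U' where "U' = {w \<in> U. a \<bullet> w = 0}"
  have "v \<noteq> 0" "a \<noteq> 0" using v a by auto
  have dT: "dim T' + 1 = dim T" unfolding T'_def
    by (rule dim_orthogonal_complement_vector) (use v \<open>v \<noteq> 0\<close> Suc.prems in auto)
  have dU: "dim U' + 1 = dim U" unfolding U'_def
    by (rule dim_orthogonal_complement_vector) (use a \<open>a \<noteq> 0\<close> Suc.prems in auto)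
  have sT: "subspace T'" using Suc.prems(1)
    by (auto simp: T'_def subspace_def inner_add_right)
  have sU: "subspace U'" using Suc.prems(2)
    by (auto simp: U'_def subspace_def inner_add_right)
  have AT: "A ` T' \<subseteq> U'"
  proof
    fix y assume "y \<in> A ` T'"
    then obtain w where w: "y = A w" "w \<in> T" "v \<bullet> w = 0" by (auto simp: T'_def)
    have "a \<bullet> A w = 0"
    proof (cases "A v = 0")
      case True
      then have "A w = 0" using max[OF w(2)] by simp
      then show ?thesis by simp
    next
      case False
      have "norm (A v) * (a \<bullet> A w) = A v \<bullet> A w" using a(3) by (metis inner_scaleR_left)
      then show ?thesis using orth[OF w(2,3)] False by simp
    qed
    then show "y \<in> U'" using w Suc.prems(3) by (auto simp: U'_def)
  qed
  have "d = dim T'" "dim T' \<le> dim U'" using dT dU Suc.hyps(2) Suc.prems(4) by linarith+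
  from Suc.hyps(1)[OF this(1) sT sU AT this(2)]
  obtain B u where B: "finite B" "B \<subseteq> T'" "u ` B \<subseteq> U'" "orthonormal_family id B"
      "orthonormal_family u B" "\<And>b. b \<in> B \<Longrightarrow> A b = norm (A b) *\<^sub>R u b"
      "\<And>x. x \<in> T' \<Longrightarrow> x = (\<Sum>b\<in>B. (x \<bullet> b) *\<^sub>R b)"
    by blast
  have vb: "v \<bullet> b = 0" "b \<bullet> v = 0" "a \<bullet> u b = 0" "u b \<bullet> a = 0" if "b \<in> B" for b
    using that B(2,3) by (auto simp: T'_def U'_def inner_commute)
  have vnB: "v \<notin> B" using vb(1) \<open>v \<noteq> 0\<close> by fastforce
  define u' where "u' = u(v := a)"
  have u'b: "u' b = u b" if "b \<in> B" for b using that vnB by (auto simp: u'_def)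
  have u'v: "u' v = a" by (simp add: u'_def)
  have vv: "v \<bullet> v = 1" "a \<bullet> a = 1" using v a by (auto simp: norm_eq_1)
  have "orthonormal_family id (insert v B)"
    using B(4) vb vv vnB by (auto simp: orthonormal_family_def)
  moreover have "orthonormal_family u' (insert v B)"
    using B(5) vb vv vnB by (auto simp: orthonormal_family_def u'b u'v)
  moreover have "x = (\<Sum>b\<in>insert v B. (x \<bullet> b) *\<^sub>R b)" if x: "x \<in> T" for x
  proof -
    define w where "w = x - (x \<bullet> v) *\<^sub>R v"
    have "w \<in> T'" using x v vv Suc.prems(1)
      by (auto simp: w_def T'_def subspace_diff subspace_scale inner_diff_right inner_commute)
    then have "w = (\<Sum>b\<in>B. (w \<bullet> b) *\<^sub>R b)" by (rule B(7))
    also have "\<dots> = (\<Sum>b\<in>B. (x \<bullet> b) *\<^sub>R b)"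
      by (rule sum.cong) (auto simp: w_def inner_diff_left vb)
    finally show ?thesis using vnB B(1) by (simp add: w_def algebra_simps)
  qed
  moreover have "A b = norm (A b) *\<^sub>R u' b" if "b \<in> insert v B" for b
    using that a(3) B(6) u'b u'v by auto
  moreover have "u' ` insert v B \<subseteq> U" "insert v B \<subseteq> T"
    using B(2,3) a v by (auto simp: u'b u'v T'_def U'_def)
  moreover have "finite (insert v B)" using B(1) by simp
  ultimately show ?case by blast
qed

section \<open>The Frobenius norm and orthonormal systems\<close>

lemma norm_matrix_rows:
  fixes M :: "real^'r^'n"
  shows "(norm M)\<^sup>2 = (\<Sum>i\<in>UNIV. (norm (M $ i))\<^sup>2)"
  by (simp add: norm_vec_def L2_set_def sum_nonneg)

lemma norm_matrix_entries:
  fixes M :: "real^'r^'n"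
  shows "(norm M)\<^sup>2 = (\<Sum>i\<in>UNIV. \<Sum>j\<in>UNIV. (M $ i $ j)\<^sup>2)"
  by (simp add: norm_matrix_eq_frobenius sum_nonneg)

lemma norm_matrix_columns:
  fixes M :: "real^'r^'n"
  shows "(norm M)\<^sup>2 = (\<Sum>j\<in>UNIV. (norm (column j M))\<^sup>2)"
proof -
  have "(norm (column j M))\<^sup>2 = (\<Sum>i\<in>UNIV. (M $ i $ j)\<^sup>2)" for j
    by (simp add: norm_vec_def L2_set_def sum_nonneg column_def)
  then show ?thesis unfolding norm_matrix_entries by (subst sum.swap) simp
qed

lemma norm_matrix_mono:
  fixes A B :: "real^'r^'n"
  assumes "\<And>i j. \<bar>A $ i $ j\<bar> \<le> \<bar>B $ i $ j\<bar>"
  shows "norm A \<le> norm B"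
proof (rule power2_le_imp_le)
  show "(norm A)\<^sup>2 \<le> (norm B)\<^sup>2"
    unfolding norm_matrix_entries
    by (intro sum_mono) (use assms in \<open>simp add: abs_le_square_iff\<close>)
qed simp

lemma inner_sum_scaleR:
  "(\<Sum>b\<in>B. c b *\<^sub>R u b) \<bullet> (\<Sum>e\<in>D. d e *\<^sub>R w e) = (\<Sum>b\<in>B. \<Sum>e\<in>D. c b * (d e * (u b \<bullet> w e)))"
  by (subst inner_sum_left) (simp add: inner_sum_right mult.left_commute)

lemma norm_sq_orthonormal_combination:
  assumes "finite B" "orthonormal_family u B"
  shows "(norm (\<Sum>b\<in>B. c b *\<^sub>R u b))\<^sup>2 = (\<Sum>b\<in>B. (c b)\<^sup>2)"
proof -
  have "(norm (\<Sum>b\<in>B. c b *\<^sub>R u b))\<^sup>2 = (\<Sum>b\<in>B. \<Sum>d\<in>B. c b * (c d * (u b \<bullet> u d)))"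
    by (simp only: power2_norm_eq_inner inner_sum_scaleR)
  also have "\<dots> = (\<Sum>b\<in>B. \<Sum>d\<in>B. if b = d then (c b)\<^sup>2 else 0)"
    using assms(2) by (intro sum.cong) (auto simp: orthonormal_family_def power2_eq_square)
  finally show ?thesis using assms(1) by simp
qed

lemma bessel_inequality:
  assumes B: "finite B" "orthonormal_family id B"
  shows "(\<Sum>b\<in>B. (x \<bullet> b)\<^sup>2) \<le> (norm x)\<^sup>2"
proof -
  define p where "p = (\<Sum>b\<in>B. (x \<bullet> b) *\<^sub>R b)"
  have p: "(norm p)\<^sup>2 = (\<Sum>b\<in>B. (x \<bullet> b)\<^sup>2)"
    using norm_sq_orthonormal_combination[OF B, of "\<lambda>b. x \<bullet> b"] by (simp add: p_def)
  have xp: "x \<bullet> p = (\<Sum>b\<in>B. (x \<bullet> b)\<^sup>2)"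
    by (simp add: p_def inner_sum_right power2_eq_square)
  have "0 \<le> (norm (x - p))\<^sup>2" by simp
  also have "\<dots> = (norm x)\<^sup>2 - 2 * (x \<bullet> p) + (norm p)\<^sup>2"
    by (simp add: power2_norm_eq_inner inner_diff_left inner_diff_right inner_commute)
  finally show ?thesis using p xp by simp
qed

lemma sum_norm_orthonormal_le:
  fixes M :: "real^'r^'n"
  assumes B: "finite B" "orthonormal_family id B"
  shows "(\<Sum>b\<in>B. (norm (M *v b))\<^sup>2) \<le> (norm M)\<^sup>2"
proof -
  have "(norm (M *v b))\<^sup>2 = (\<Sum>i\<in>UNIV. (M $ i \<bullet> b)\<^sup>2)" for b
    by (simp add: norm_vec_def L2_set_def sum_nonneg matrix_vector_mul_component)
  then have "(\<Sum>b\<in>B. (norm (M *v b))\<^sup>2) = (\<Sum>i\<in>UNIV. \<Sum>b\<in>B. (M $ i \<bullet> b)\<^sup>2)"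
    by simp (rule sum.swap)
  also have "\<dots> \<le> (\<Sum>i\<in>UNIV. (norm (M $ i))\<^sup>2)"
    by (intro sum_mono bessel_inequality B)
  finally show ?thesis by (simp add: norm_matrix_rows)
qed

lemma norm_eq_sum_orthonormal:
  fixes M :: "real^'r^'n"
  assumes B: "finite B" "orthonormal_family id B"
    and rows: "\<And>i. M $ i = (\<Sum>b\<in>B. (M $ i \<bullet> b) *\<^sub>R b)"
  shows "(norm M)\<^sup>2 = (\<Sum>b\<in>B. (norm (M *v b))\<^sup>2)"
proof -
  have "(norm (M $ i))\<^sup>2 = (\<Sum>b\<in>B. (M $ i \<bullet> b)\<^sup>2)" for i
    using norm_sq_orthonormal_combination[OF B, of "\<lambda>b. M $ i \<bullet> b"] rows[of i] by simp
  then have "(norm M)\<^sup>2 = (\<Sum>b\<in>B. \<Sum>i\<in>UNIV. (M $ i \<bullet> b)\<^sup>2)"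
    by (simp add: norm_matrix_rows) (rule sum.swap)
  also have "\<dots> = (\<Sum>b\<in>B. (norm (M *v b))\<^sup>2)"
    by (simp add: norm_vec_def L2_set_def sum_nonneg matrix_vector_mul_component)
  finally show ?thesis .
qed

section \<open>Approximation by a partial isometry\<close>

text \<open>
  The partial isometry is a polar factor of \<open>A\<close>: it replaces every singular value \<open>\<sigma>\<close> by 1. The
  squared distance is then the sum of the \<open>(\<sigma> - 1)\<^sup>2\<close>, and \<open>(\<sigma> - 1)\<^sup>2 \<le> \<bar>\<sigma>\<^sup>2 - 1\<bar>\<close>. Estimating by the
  first power of \<open>\<sigma>\<^sup>2 - 1\<close> costs a square root in the final error, but it needs no lower bound on the
  singular values: \<open>A\<close> may be rank deficient on \<open>T\<close>.
\<close>

proposition nearby_partial_isometry: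
  fixes A :: "real^'r^'n"
  assumes T: "subspace T" and U: "subspace U" and dim: "dim T \<le> dim U"
    and rows: "\<And>i. A $ i \<in> T" and AU: "\<And>x. A *v x \<in> U"
  obtains B V where "finite B" "orthonormal_family id B" "B \<subseteq> T"
    "\<And>i. V $ i \<in> T" "\<And>x. V *v x \<in> U" "\<And>x y. x \<in> T \<Longrightarrow> y \<in> T \<Longrightarrow> (V *v x) \<bullet> (V *v y) = x \<bullet> y"
    "(norm (A - V))\<^sup>2 \<le> (\<Sum>b\<in>B. \<bar>(norm (A *v b))\<^sup>2 - 1\<bar>)"
proof -
  have "(*v) A ` T \<subseteq> U" using AU by blast
  from singular_value_decomposition[OF matrix_vector_mul_linear T U this dim]
  obtain B u where B: "finite B" "B \<subseteq> T" "u ` B \<subseteq> U" "orthonormal_family id B"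
      "orthonormal_family u B" "\<And>b. b \<in> B \<Longrightarrow> A *v b = norm (A *v b) *\<^sub>R u b"
      "\<And>x. x \<in> T \<Longrightarrow> x = (\<Sum>b\<in>B. (x \<bullet> b) *\<^sub>R b)"
    by blast
  define V :: "real^'r^'n" where "V = (\<chi> i. \<Sum>b\<in>B. (u b $ i) *\<^sub>R b)"
  have Vx: "V *v x = (\<Sum>b\<in>B. (x \<bullet> b) *\<^sub>R u b)" for x
    by (simp add: vec_eq_iff matrix_vector_mul_component V_def inner_sum_left sum_component)
      (simp add: mult.commute inner_commute)
  have VT: "V $ i \<in> T" for i
    using B(2) T by (auto simp: V_def intro!: subspace_sum subspace_scale)
  have VU: "V *v x \<in> U" for x
    unfolding Vx using B(3) U by (auto intro!: subspace_sum subspace_scale)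
  have Vb: "V *v b = u b" if "b \<in> B" for b
  proof -
    have "V *v b = (\<Sum>d\<in>B. if d = b then u b else 0)"
      unfolding Vx using B(4) that by (intro sum.cong) (auto simp: orthonormal_family_def)
    then show ?thesis using B(1) that by simp
  qed
  have iso: "(V *v x) \<bullet> (V *v y) = x \<bullet> y" if "x \<in> T" "y \<in> T" for x y
  proof -
    have "(V *v x) \<bullet> (V *v y) = (\<Sum>b\<in>B. \<Sum>d\<in>B. (x \<bullet> b) * ((y \<bullet> d) * (u b \<bullet> u d)))"
      by (simp only: Vx inner_sum_scaleR)
    also have "\<dots> = (\<Sum>b\<in>B. \<Sum>d\<in>B. (x \<bullet> b) * ((y \<bullet> d) * (b \<bullet> d)))"
      using B(4,5) by (intro sum.cong) (auto simp: orthonormal_family_def)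
    also have "\<dots> = (\<Sum>b\<in>B. (x \<bullet> b) *\<^sub>R b) \<bullet> (\<Sum>b\<in>B. (y \<bullet> b) *\<^sub>R b)"
      by (simp only: inner_sum_scaleR)
    finally show ?thesis by (simp only: B(7)[OF that(1), symmetric] B(7)[OF that(2), symmetric])
  qed
  have rw: "(A - V) $ i = (\<Sum>b\<in>B. ((A - V) $ i \<bullet> b) *\<^sub>R b)" for i
    by (rule B(7)) (use rows VT T in \<open>auto simp: subspace_diff\<close>)
  have "(norm (A - V))\<^sup>2 = (\<Sum>b\<in>B. (norm ((A - V) *v b))\<^sup>2)"
    by (rule norm_eq_sum_orthonormal[OF B(1,4) rw])
  also have "\<dots> \<le> (\<Sum>b\<in>B. \<bar>(norm (A *v b))\<^sup>2 - 1\<bar>)"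
  proof (rule sum_mono)
    fix b assume b: "b \<in> B"
    define s where "s = norm (A *v b)"
    have "u b \<bullet> u b = 1" using B(5) b by (auto simp: orthonormal_family_def)
    then have nu: "norm (u b) = 1" by (simp add: norm_eq_1)
    have "(A - V) *v b = (s - 1) *\<^sub>R u b"
      using B(6)[OF b] Vb[OF b] by (simp add: matrix_vector_mult_diff_rdistrib s_def scaleR_left_diff_distrib)
    then have "(norm ((A - V) *v b))\<^sup>2 = \<bar>s - 1\<bar> * \<bar>s - 1\<bar>"
      using nu by (simp add: power2_eq_square)
    also have "\<dots> \<le> \<bar>s - 1\<bar> * \<bar>s + 1\<bar>"
      by (intro mult_left_mono) (auto simp: s_def abs_le_iff)
    also have "\<dots> = \<bar>s\<^sup>2 - 1\<bar>"
      by (simp add: abs_mult[symmetric] power2_eq_square algebra_simps)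
    finally show "(norm ((A - V) *v b))\<^sup>2 \<le> \<bar>(norm (A *v b))\<^sup>2 - 1\<bar>" by (simp add: s_def)
  qed
  finally show ?thesis using that[OF B(1,4,2) VT VU iso] by blast
qed

section \<open>Estimates in terms of the Gram matrix\<close>

lemma sum_norm_component_le:
  fixes x :: "'a::real_normed_vector^'r"
  shows "(\<Sum>k\<in>UNIV. norm (x $ k)) \<le> sqrt (real CARD('r)) * norm x"
  using L2_set_mult_ineq[of "\<lambda>k. 1" "\<lambda>k. norm (x $ k)" UNIV]
  by (simp add: norm_vec_def L2_set_def)

lemma sum_abs_row_le:
  fixes E :: "real^'r^'m"
  shows "(\<Sum>k\<in>UNIV. \<bar>E $ j $ k\<bar>) \<le> sqrt (real CARD('r)) * norm E"
proof -
  have "(\<Sum>k\<in>UNIV. \<bar>E $ j $ k\<bar>) \<le> sqrt (real CARD('r)) * norm (E $ j)"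
    using sum_norm_component_le[of "E $ j"] by simp
  also have "\<dots> \<le> sqrt (real CARD('r)) * norm E"
    by (intro mult_left_mono Finite_Cartesian_Product.norm_nth_le) auto
  finally show ?thesis .
qed

lemma sum_abs_entries_le:
  fixes E :: "real^'r^'r"
  shows "(\<Sum>j\<in>UNIV. \<Sum>k\<in>UNIV. \<bar>E $ j $ k\<bar>) \<le> real CARD('r) * norm E"
proof -
  have "(\<Sum>j\<in>UNIV. \<Sum>k\<in>UNIV. \<bar>E $ j $ k\<bar>) \<le> (\<Sum>j\<in>UNIV. sqrt (real CARD('r)) * norm (E $ j))"
    by (rule sum_mono) (use sum_norm_component_le[of "E $ _"] in simp)
  also have "\<dots> \<le> sqrt (real CARD('r)) * (sqrt (real CARD('r)) * norm E)"
    unfolding sum_distrib_left[symmetric] by (intro mult_left_mono sum_norm_component_le) auto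
  finally show ?thesis by (simp add: mult.assoc[symmetric])
qed

lemma norm_matrix_vector_mult_le:
  fixes E :: "real^'r^'m"
  shows "norm (E *v x) \<le> norm E * norm x"
proof (rule power2_le_imp_le)
  have "(norm (E *v x))\<^sup>2 = (\<Sum>i\<in>UNIV. (E $ i \<bullet> x)\<^sup>2)"
    by (simp add: norm_vec_def L2_set_def sum_nonneg matrix_vector_mul_component)
  also have "\<dots> \<le> (\<Sum>i\<in>UNIV. (norm (E $ i))\<^sup>2 * (norm x)\<^sup>2)"
    by (intro sum_mono) (metis Cauchy_Schwarz_ineq power2_norm_eq_inner)
  finally show "(norm (E *v x))\<^sup>2 \<le> (norm E * norm x)\<^sup>2"
    by (simp add: norm_matrix_rows sum_distrib_right power_mult_distrib)
qed auto

lemma inner_transpose_matrix_vector: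
  fixes Y :: "real^'r^'n"
  shows "(transpose Y *v d) \<bullet> x = d \<bullet> (Y *v x)"
  by (simp add: dot_lmul_matrix)

text \<open>
  This identity and the two bounds after it control \<open>Y\<close> and its transpose as operators by
  \<open>sqrt (1 + \<beta>)\<close>, where \<open>\<beta>\<close> is the defect of the Gram matrix. The Frobenius norm of \<open>Y\<close>, about
  \<open>sqrt r\<close>, would be too large for the dependence on \<open>r\<close> that is claimed.
\<close>

lemma norm_sq_matrix_vector_gram:
  fixes Y :: "real^'r^'n"
  shows "(norm (Y *v x))\<^sup>2 = (norm x)\<^sup>2 + x \<bullet> ((transpose Y ** Y - mat 1) *v x)"
proof -
  have "(Y *v x) \<bullet> (Y *v x) = x \<bullet> ((transpose Y ** Y) *v x)"
    by (simp only: matrix_vector_mul_assoc[symmetric] inner_transpose_matrix_vector inner_commute[of x])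
  then show ?thesis
    by (simp add: power2_norm_eq_inner matrix_vector_mult_diff_rdistrib inner_diff_right)
qed

lemma norm_matrix_vector_gram_le:
  fixes Y :: "real^'r^'n"
  shows "norm (Y *v x) \<le> sqrt (1 + norm (transpose Y ** Y - mat 1)) * norm x"
proof -
  let ?E = "transpose Y ** Y - mat 1"
  have "x \<bullet> (?E *v x) \<le> norm x * (norm ?E * norm x)"
    by (intro order_trans[OF norm_cauchy_schwarz] mult_left_mono norm_matrix_vector_mult_le) auto
  then have "(norm (Y *v x))\<^sup>2 \<le> (1 + norm ?E) * (norm x)\<^sup>2"
    unfolding norm_sq_matrix_vector_gram by (simp add: algebra_simps power2_eq_square)
  then have "sqrt ((norm (Y *v x))\<^sup>2) \<le> sqrt ((1 + norm ?E) * (norm x)\<^sup>2)"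
    by (rule real_sqrt_le_mono)
  then show ?thesis by (simp add: real_sqrt_mult)
qed

lemma norm_transpose_vector_gram_le:
  fixes Y :: "real^'r^'n"
  shows "norm (transpose Y *v d) \<le> sqrt (1 + norm (transpose Y ** Y - mat 1)) * norm d"
proof -
  let ?s = "sqrt (1 + norm (transpose Y ** Y - mat 1))"
  let ?z = "transpose Y *v d"
  have "norm ?z * norm ?z = d \<bullet> (Y *v ?z)"
    by (metis inner_transpose_matrix_vector power2_eq_square power2_norm_eq_inner)
  also have "\<dots> \<le> norm d * (?s * norm ?z)"
    by (intro order_trans[OF norm_cauchy_schwarz] mult_left_mono norm_matrix_vector_gram_le) auto
  finally have "norm ?z * norm ?z \<le> (?s * norm d) * norm ?z" by (simp add: mult_ac)
  then show ?thesis
    by (cases "norm ?z = 0") (auto simp: mult_le_cancel_right)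
qed

lemma column_matrix_matrix_mult:
  fixes A :: "real^'r^'n" and D :: "real^'m^'r"
  shows "column j (A ** D) = A *v column j D"
  by (simp add: vec_eq_iff column_def matrix_matrix_mult_def matrix_vector_mult_def)

lemma norm_transpose_matrix_gram_le:
  fixes Y :: "real^'r^'n" and D :: "real^'m^'n"
  shows "norm (transpose Y ** D) \<le> sqrt (1 + norm (transpose Y ** Y - mat 1)) * norm D"
proof (rule power2_le_imp_le)
  let ?s = "sqrt (1 + norm (transpose Y ** Y - mat 1))"
  have "(norm (transpose Y ** D))\<^sup>2 = (\<Sum>j\<in>UNIV. (norm (transpose Y *v column j D))\<^sup>2)"
    by (simp only: norm_matrix_columns column_matrix_matrix_mult)
  also have "\<dots> \<le> (\<Sum>j\<in>UNIV. (?s * norm (column j D))\<^sup>2)"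
    by (intro sum_mono power_mono norm_transpose_vector_gram_le) auto
  finally show "(norm (transpose Y ** D))\<^sup>2 \<le> (?s * norm D)\<^sup>2"
    by (simp only: norm_matrix_columns[of D] power_mult_distrib sum_distrib_left)
qed auto

lemma norm_transpose: "norm (transpose M) = norm (M :: real^'r^'n)"
proof -
  have "(norm (transpose M))\<^sup>2 = (norm M)\<^sup>2"
    unfolding norm_matrix_entries by (simp add: transpose_def) (rule sum.swap)
  then show ?thesis by simp
qed

lemma norm_matrix_mult_le:
  fixes A :: "real^'r^'n" and D :: "real^'m^'r"
  shows "norm (A ** D) \<le> norm A * norm D"
proof (rule power2_le_imp_le)
  have "(norm (A ** D))\<^sup>2 = (\<Sum>j\<in>UNIV. (norm (A *v column j D))\<^sup>2)"
    by (simp only: norm_matrix_columns column_matrix_matrix_mult)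
  also have "\<dots> \<le> (\<Sum>j\<in>UNIV. (norm A * norm (column j D))\<^sup>2)"
    by (intro sum_mono power_mono norm_matrix_vector_mult_le) auto
  finally show "(norm (A ** D))\<^sup>2 \<le> (norm A * norm D)\<^sup>2"
    by (simp only: norm_matrix_columns[of D] power_mult_distrib sum_distrib_left)
qed auto

text \<open>
  Truncating the entries of the wrong sign adds a matrix \<open>D\<close> of the size of the sign violation; this
  bounds the resulting loss of orthonormality.
\<close>

lemma gram_perturbation:
  fixes X D :: "real^'r^'n"
  defines "b \<equiv> norm (transpose X ** X - mat 1)"
  shows "norm (transpose (X + D) ** (X + D) - mat 1) \<le> b + 2 * sqrt (1 + b) * norm D + (norm D)\<^sup>2"
proof -
  have eq: "transpose (X + D) ** (X + D) - mat 1
      = (transpose X ** X - mat 1) + (transpose X ** D + (transpose (transpose X ** D) + transpose D ** D))"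
    by (simp add: vec_eq_iff matrix_matrix_mult_def transpose_def algebra_simps sum.distrib)
  have 1: "norm (transpose X ** D) \<le> sqrt (1 + b) * norm D"
    unfolding b_def by (rule norm_transpose_matrix_gram_le)
  have 2: "norm (transpose D ** D) \<le> norm D * norm D"
    using norm_matrix_mult_le[of "transpose D" D] by (simp add: norm_transpose)
  have "norm (transpose (X + D) ** (X + D) - mat 1)
      \<le> b + (norm (transpose X ** D) + (norm (transpose X ** D) + norm (transpose D ** D)))"
    unfolding eq b_def
    by (intro norm_triangle_le add_left_mono) (use norm_transpose[of "transpose X ** D"] in \<open>auto intro!: norm_triangle_le\<close>)
  with 1 2 show ?thesis by (simp add: power2_eq_square)
qed

definition coordinate_projection :: "'r set \<Rightarrow> real^'r^'r" where
  "coordinate_projection C = (\<chi> j k. if j = k \<and> j \<in> C then 1 else 0)"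

lemma gram_entry:
  fixes Y :: "real^'r^'n"
  shows "(transpose Y ** Z) $ j $ k = (\<Sum>i\<in>UNIV. Y $ i $ j * Z $ i $ k)"
  by (simp add: matrix_matrix_mult_def transpose_def)

section \<open>Rounding nonnegative columns to disjoint supports\<close>

text \<open>
  Nonnegative columns are orthogonal exactly when their supports are disjoint. So keep in each row
  only the largest of the entries in the columns of \<open>C\<close>, and normalise the columns. An entry
  \<open>y\<^sub>i\<^sub>j\<close> that is dropped satisfies \<open>y\<^sub>i\<^sub>j\<^sup>2 \<le> y\<^sub>i\<^sub>j y\<^sub>i\<^sub>k\<close> for the column \<open>k\<close> that is kept in row \<open>i\<close>,
  and since all products of entries in these columns are nonnegative, the mass dropped from column \<open>j\<close>
  is at most the sum of the Gram matrix entries \<open>(j, k)\<close> over the other columns \<open>k\<close> in \<open>C\<close>.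
  The smallness hypothesis bounds this sum together with the defect of the diagonal entry by a number
  below 1, so no column vanishes.
\<close>

proposition round_nonnegative_columns:
  fixes Y :: "real^'r^'n" and C :: "'r set"
  defines "\<beta> \<equiv> norm (transpose Y ** Y - mat 1)"
  assumes nonneg: "\<And>i j. j \<in> C \<Longrightarrow> Y $ i $ j \<ge> 0" and small: "sqrt (real CARD('r)) * \<beta> < 1"
  obtains W :: "real^'r^'n" where
    "\<And>i j. W $ i $ j \<ge> 0" "\<And>i j. j \<notin> C \<Longrightarrow> W $ i $ j = 0"
    "transpose W ** W = coordinate_projection C"
    "(\<Sum>j\<in>C. \<Sum>i\<in>UNIV. (Y $ i $ j - W $ i $ j)\<^sup>2) \<le> 2 * real CARD('r) * \<beta>"
proof -
  define E where "E = transpose Y ** Y - mat 1"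
  have gram: "(\<Sum>i\<in>UNIV. Y $ i $ j * Y $ i $ k) = (if j = k then 1 else 0) + E $ j $ k" for j k
    unfolding E_def by (simp add: gram_entry mat_def)
  have "\<exists>m. C \<noteq> {} \<longrightarrow> m \<in> C \<and> (\<forall>k\<in>C. Y $ i $ k \<le> Y $ i $ m)" for i
  proof (cases "C = {}")
    case False
    have "Max ((\<lambda>k. Y $ i $ k) ` C) \<in> (\<lambda>k. Y $ i $ k) ` C"
      using False by (intro Max_in) auto
    then obtain l where l: "l \<in> C" "Max ((\<lambda>k. Y $ i $ k) ` C) = Y $ i $ l" by auto
    have "Y $ i $ k \<le> Y $ i $ l" if "k \<in> C" for k
      unfolding l(2)[symmetric] using that by (intro Max_ge) auto
    then show ?thesis using l(1) by blast
  qed simp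
  then obtain m where m: "\<And>i. C \<noteq> {} \<Longrightarrow> m i \<in> C" "\<And>i k. k \<in> C \<Longrightarrow> Y $ i $ k \<le> Y $ i $ m i"
    by (metis empty_iff)
  \<comment> \<open>\<open>z\<close> is the rounded matrix, \<open>e j\<close> the mass that column \<open>j\<close> loses and \<open>q j\<close> the mass that it keeps.\<close>
  define z where "z i j = (if m i = j then Y $ i $ j else 0)" for i j
  define e where "e j = (\<Sum>i\<in>UNIV. (Y $ i $ j - z i j)\<^sup>2)" for j
  define q where "q j = (\<Sum>i\<in>UNIV. (z i j)\<^sup>2)" for j
  have e_le: "e j \<le> (\<Sum>k\<in>UNIV-{j}. \<bar>E $ j $ k\<bar>)" if j: "j \<in> C" for j
  proof -
    have "(Y $ i $ j - z i j)\<^sup>2 \<le> (\<Sum>k\<in>C-{j}. Y $ i $ j * Y $ i $ k)" for i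
    proof (cases "m i = j")
      case True
      then show ?thesis using nonneg j by (auto simp: z_def intro!: sum_nonneg)
    next
      case False
      have mi: "m i \<in> C" using m(1) j by auto
      have "(Y $ i $ j - z i j)\<^sup>2 \<le> Y $ i $ j * Y $ i $ m i"
        using False m(2)[OF j] nonneg[OF j] by (simp add: z_def power2_eq_square mult_left_mono)
      also have "\<dots> \<le> (\<Sum>k\<in>C-{j}. Y $ i $ j * Y $ i $ k)"
        using False mi nonneg j by (intro member_le_sum) auto
      finally show ?thesis .
    qed
    then have "e j \<le> (\<Sum>i\<in>UNIV. \<Sum>k\<in>C-{j}. Y $ i $ j * Y $ i $ k)"
      unfolding e_def by (rule sum_mono)
    also have "\<dots> = (\<Sum>k\<in>C-{j}. E $ j $ k)"
      by (subst sum.swap) (intro sum.cong, auto simp: gram)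
    also have "\<dots> \<le> (\<Sum>k\<in>C-{j}. \<bar>E $ j $ k\<bar>)" by (intro sum_mono) auto
    also have "\<dots> \<le> (\<Sum>k\<in>UNIV-{j}. \<bar>E $ j $ k\<bar>)" by (intro sum_mono2) auto
    finally show ?thesis .
  qed
  have qe: "q j = 1 + E $ j $ j - e j" for j
  proof -
    have "q j + e j = (\<Sum>i\<in>UNIV. Y $ i $ j * Y $ i $ j)"
      unfolding q_def e_def sum.distrib[symmetric]
      by (intro sum.cong) (auto simp: z_def power2_eq_square)
    then show ?thesis using gram[of j j] by simp
  qed
  have row_split: "(\<Sum>k\<in>UNIV. \<bar>E $ j $ k\<bar>) = \<bar>E $ j $ j\<bar> + (\<Sum>k\<in>UNIV-{j}. \<bar>E $ j $ k\<bar>)" for j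
    by (simp add: sum.remove)
  have q_pos: "q j > 0" if "j \<in> C" for j
    using e_le[OF that] qe[of j] row_split[of j] sum_abs_row_le[of E j] small
    by (simp add: \<beta>_def E_def[symmetric])
  define W :: "real^'r^'n" where "W = (\<chi> i j. if j \<in> C then z i j / sqrt (q j) else 0)"
  have W_nonneg: "W $ i $ j \<ge> 0" for i j
    using nonneg q_pos[of j] by (auto simp: W_def z_def)
  have W_gram: "transpose W ** W = coordinate_projection C"
  proof -
    have "(transpose W ** W) $ j $ k = coordinate_projection C $ j $ k" for j k
    proof (cases "j \<in> C \<and> k \<in> C")
      case False
      then show ?thesis by (auto simp: gram_entry W_def coordinate_projection_def)
    next
      case True
      show ?thesis
      proof (cases "j = k")
        case False
        then have "(\<Sum>i\<in>UNIV. W $ i $ j * W $ i $ k) = 0"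
          by (intro sum.neutral) (auto simp: W_def z_def)
        then show ?thesis using False by (simp add: gram_entry coordinate_projection_def)
      next
        case eq: True
        have "(\<Sum>i\<in>UNIV. W $ i $ j * W $ i $ j) = (\<Sum>i\<in>UNIV. (z i j)\<^sup>2 / q j)"
          using True q_pos[of j] by (intro sum.cong) (auto simp: W_def power2_eq_square)
        also have "\<dots> = 1" using q_pos[of j] True by (simp add: sum_divide_distrib[symmetric] q_def[symmetric])
        finally show ?thesis using eq True by (simp add: gram_entry coordinate_projection_def)
      qed
    qed
    then show ?thesis by (simp add: vec_eq_iff)
  qed
  have col: "(\<Sum>i\<in>UNIV. (Y $ i $ j - W $ i $ j)\<^sup>2) \<le> 2 * (\<Sum>k\<in>UNIV. \<bar>E $ j $ k\<bar>)" if j: "j \<in> C" for j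
  proof -
    have qp: "q j > 0" by (rule q_pos[OF j])
    have "(\<Sum>i\<in>UNIV. (Y $ i $ j - W $ i $ j)\<^sup>2)
        = (\<Sum>i\<in>UNIV. Y $ i $ j * Y $ i $ j + (z i j)\<^sup>2 / q j - 2 * ((z i j)\<^sup>2 / sqrt (q j)))"
    proof (intro sum.cong refl)
      fix i
      have yz: "Y $ i $ j * z i j = (z i j)\<^sup>2" by (simp add: z_def power2_eq_square)
      have "(Y $ i $ j - W $ i $ j)\<^sup>2 = Y $ i $ j * Y $ i $ j + (W $ i $ j)\<^sup>2 - 2 * (Y $ i $ j * W $ i $ j)"
        by (simp add: power2_eq_square algebra_simps)
      also have "(W $ i $ j)\<^sup>2 = (z i j)\<^sup>2 / q j" using j qp by (simp add: W_def power_divide)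
      also have "Y $ i $ j * W $ i $ j = (z i j)\<^sup>2 / sqrt (q j)" using j by (simp add: W_def yz)
      finally show "(Y $ i $ j - W $ i $ j)\<^sup>2
        = Y $ i $ j * Y $ i $ j + (z i j)\<^sup>2 / q j - 2 * ((z i j)\<^sup>2 / sqrt (q j))" .
    qed
    also have "\<dots> = (1 + E $ j $ j) + 1 - 2 * (q j / sqrt (q j))"
      using qp by (simp add: sum.distrib sum_subtractf gram sum_distrib_left[symmetric]
          sum_divide_distrib[symmetric] q_def[symmetric])
    also have "q j / sqrt (q j) = sqrt (q j)" using qp by (simp add: real_div_sqrt)
    finally have eq: "(\<Sum>i\<in>UNIV. (Y $ i $ j - W $ i $ j)\<^sup>2) = 2 + E $ j $ j - 2 * sqrt (q j)" by simp
    \<comment> \<open>\<open>2 - 2 sqrt q\<close> is bounded by \<open>2 - 2 q\<close> when \<open>q \<le> 1\<close> and by 0 otherwise.\<close>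
    have "sqrt (q j) \<ge> min (q j) 1"
    proof (cases "q j \<le> 1")
      case True
      then have "sqrt (q j * q j) \<le> sqrt (q j)" using qp by (intro real_sqrt_le_mono) (simp add: mult_le_cancel_left1)
      then show ?thesis using qp True by simp
    qed (simp add: min_def)
    moreover have "e j \<ge> 0" by (simp add: e_def sum_nonneg)
    ultimately show ?thesis using eq e_le[OF j] qe[of j] row_split[of j] by linarith
  qed
  have "(\<Sum>j\<in>C. \<Sum>i\<in>UNIV. (Y $ i $ j - W $ i $ j)\<^sup>2) \<le> (\<Sum>j\<in>C. 2 * (\<Sum>k\<in>UNIV. \<bar>E $ j $ k\<bar>))"
    by (intro sum_mono col)
  also have "\<dots> \<le> (\<Sum>j\<in>UNIV. 2 * (\<Sum>k\<in>UNIV. \<bar>E $ j $ k\<bar>))"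
    by (intro sum_mono2) (auto simp: sum_nonneg)
  also have "\<dots> \<le> 2 * real CARD('r) * \<beta>"
    using sum_abs_entries_le[of E] by (simp add: sum_distrib_left[symmetric] \<beta>_def E_def)
  finally show ?thesis
    by (intro that[of W] W_nonneg W_gram) (auto simp: W_def)
qed

section \<open>Completing the rounded columns to a full frame\<close>

lemma dim_vanishing_coordinates:
  fixes C :: "'r::finite set"
  shows "dim {v :: real^'r. \<forall>j\<in>C. v $ j = 0} = CARD('r) - card C"
  using dim_substandard_cart[of "- C", where 'a = real]
  by (simp add: dim_vec_eq Compl_eq_Diff_UNIV card_Diff_subset Ball_def)

lemma dim_orthogonal_to_columns:
  fixes W :: "real^'r^'n"
  assumes "\<And>j. j \<notin> C \<Longrightarrow> column j W = 0"
  shows "CARD('n) - card C \<le> dim {u. transpose W *v u = 0}"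
proof -
  define S where "S = (\<lambda>j. column j W) ` C"
  have col: "(transpose W *v u) $ j = column j W \<bullet> u" for u j
    by (simp only: matrix_vector_mul_component) (simp add: transpose_def column_def)
  have "{u. transpose W *v u = 0} = {u \<in> UNIV. \<forall>x \<in> span S. orthogonal x u}"
  proof (intro set_eqI iffI)
    fix u assume "u \<in> {u. transpose W *v u = 0}"
    then have "column j W \<bullet> u = 0" for j
      using col[of u j] by simp
    then have S: "orthogonal u x" if "x \<in> S" for x
      using that by (auto simp: S_def orthogonal_def inner_commute)
    have "orthogonal x u" if "x \<in> span S" for x
      using orthogonal_to_span[OF that S] by (simp add: orthogonal_commute)
    then show "u \<in> {u \<in> UNIV. \<forall>x \<in> span S. orthogonal x u}" by simp
  next
    fix u assume "u \<in> {u \<in> UNIV. \<forall>x \<in> span S. orthogonal x u}"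
    then have "column j W \<bullet> u = 0" for j
      using assms[of j] by (cases "j \<in> C") (auto simp: S_def orthogonal_def intro: span_base)
    then show "u \<in> {u. transpose W *v u = 0}"
      by (auto simp only: vec_eq_iff col zero_index)
  qed
  then have "dim {u. transpose W *v u = 0} + dim (span S) = dim (UNIV :: (real^'n) set)"
    by (simp only:) (rule dim_subspace_orthogonal_to_vectors, auto)
  moreover have "dim (span S) \<le> card C"
    unfolding dim_span S_def by (metis dim_le_card' card_image_le finite finite_imageI order_trans)
  ultimately show ?thesis by simp
qed

text \<open>
  Write \<open>W\<close> for the rounded columns in \<open>C\<close> and \<open>Y\<^sub>F\<close> for the columns of \<open>Y\<close> outside \<open>C\<close>, with \<open>r\<close>
  columns each, padded by zero. The columns outside \<open>C\<close> must be replaced by an orthonormal system that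
  is orthogonal to \<open>W\<close>. Subtract from \<open>Y\<^sub>F\<close> its projection \<open>W G\<close> onto the span of \<open>W\<close>, with
  \<open>G = W\<^sup>T Y\<^sub>F\<close>, and take a nearby partial isometry \<open>V\<close> of the remainder \<open>A\<close> into the orthogonal
  complement of \<open>W\<close>. Two estimates make this work. The matrix \<open>G\<close> is small, because
  \<open>G = (W - Y\<^sub>C)\<^sup>T Y\<^sub>F + Y\<^sub>C\<^sup>T Y\<^sub>F\<close>, where \<open>Y\<^sub>C\<close> is \<open>Y\<close> restricted to the columns in \<open>C\<close>: the first term
  is a rounding error and the second a block of the Gram defect. And for a unit vector \<open>b\<close> supported off \<open>C\<close>,
  Pythagoras gives \<open>\<bar>A b\<bar>\<^sup>2 = \<bar>Y b\<bar>\<^sup>2 - \<bar>G b\<bar>\<^sup>2\<close>, so \<open>\<bar>A b\<bar>\<^sup>2 - 1\<close> is controlled by the Gram defect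
  and \<open>G\<close>. All errors are compared with \<open>q = sqrt (r \<beta>)\<close>.
\<close>

proposition nearby_sign_frame:
  fixes Y :: "real^'r^'n" and C :: "'r set"
  defines "\<beta> \<equiv> norm (transpose Y ** Y - mat 1)"
  assumes card: "CARD('r) \<le> CARD('n)"
    and nonneg: "\<And>i j. j \<in> C \<Longrightarrow> Y $ i $ j \<ge> 0" and small: "sqrt (real CARD('r)) * \<beta> < 1"
  obtains Z :: "real^'r^'n" where
    "\<And>i j. j \<in> C \<Longrightarrow> Z $ i $ j \<ge> 0" "transpose Z ** Z = mat 1"
    "norm (Y - Z) \<le> 8 * sqrt (real CARD('r) * \<beta>)"
proof -
  define E where "E = transpose Y ** Y - mat 1"
  define q where "q = sqrt (real CARD('r) * \<beta>)"
  have r1: "1 \<le> real CARD('r)" by (simp add: Suc_leI)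
  have \<beta>0: "\<beta> \<ge> 0" by (simp add: \<beta>_def)
  have "1 * \<beta> \<le> sqrt (real CARD('r)) * \<beta>"
    using r1 \<beta>0 by (intro mult_right_mono) auto
  then have \<beta>1: "\<beta> < 1" using small by simp
  have q0: "q \<ge> 0" and q2: "q\<^sup>2 = real CARD('r) * \<beta>" using \<beta>0 by (auto simp: q_def)
  have "\<beta> * \<beta> \<le> 1 * \<beta>" using \<beta>0 \<beta>1 by (intro mult_right_mono) auto
  also have "\<dots> \<le> real CARD('r) * \<beta>" using r1 \<beta>0 by (intro mult_right_mono) auto
  finally have \<beta>q: "\<beta> \<le> q"
    unfolding q_def by (intro real_le_rsqrt) (simp add: power2_eq_square)
  have "sqrt (real CARD('r)) * \<beta> \<le> real CARD('r) * \<beta>"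
    using r1 \<beta>0 by (intro mult_right_mono real_le_lsqrt) (auto simp: power2_eq_square)
  then have rq: "sqrt (real CARD('r)) * \<beta> \<le> q\<^sup>2" by (simp add: q2)
  obtain W :: "real^'r^'n" where W:
    "\<And>i j. W $ i $ j \<ge> 0" "\<And>i j. j \<notin> C \<Longrightarrow> W $ i $ j = 0"
    "transpose W ** W = coordinate_projection C"
    "(\<Sum>j\<in>C. \<Sum>i\<in>UNIV. (Y $ i $ j - W $ i $ j)\<^sup>2) \<le> 2 * real CARD('r) * \<beta>"
    using round_nonnegative_columns[OF nonneg small[unfolded \<beta>_def]] unfolding \<beta>_def by blast
  define YF :: "real^'r^'n" where "YF = (\<chi> i j. if j \<in> C then 0 else Y $ i $ j)"
  define \<Delta> :: "real^'r^'n" where "\<Delta> = (Y - YF) - W"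
  define G where "G = transpose W ** YF"
  define A where "A = YF - W ** G"
  have "(norm \<Delta>)\<^sup>2 = (\<Sum>j\<in>UNIV. \<Sum>i\<in>UNIV. if j \<in> C then (Y $ i $ j - W $ i $ j)\<^sup>2 else 0)"
    unfolding norm_matrix_entries
    by (subst sum.swap) (intro sum.cong, auto simp: \<Delta>_def YF_def W(2))
  also have "\<dots> = (\<Sum>j\<in>UNIV. if j \<in> C then \<Sum>i\<in>UNIV. (Y $ i $ j - W $ i $ j)\<^sup>2 else 0)"
    by (intro sum.cong) auto
  also have "\<dots> = (\<Sum>j\<in>C. \<Sum>i\<in>UNIV. (Y $ i $ j - W $ i $ j)\<^sup>2)"
    by (simp add: sum.If_cases)
  also have "\<dots> \<le> (sqrt 2 * q)\<^sup>2" using W(4) by (simp add: q2 power_mult_distrib)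
  finally have \<delta>: "norm \<Delta> \<le> sqrt 2 * q"
    by (rule power2_le_imp_le) (simp add: q0)
  have G0: "G $ k $ j = 0" if "k \<notin> C \<or> j \<in> C" for j k
    using that by (auto simp: G_def gram_entry W(2) YF_def)
  have "\<bar>G $ k $ j\<bar> \<le> \<bar>(E - transpose (transpose Y ** \<Delta>)) $ k $ j\<bar>" for k j
  proof (cases "k \<notin> C \<or> j \<in> C")
    case True
    then show ?thesis by (simp add: G0[OF True])
  next
    case False
    then have "G $ k $ j = (E - transpose (transpose Y ** \<Delta>)) $ k $ j"
      by (auto simp: G_def E_def transpose_def matrix_matrix_mult_def \<Delta>_def YF_def mat_def
          algebra_simps sum_subtractf)
    then show ?thesis by simp
  qed
  then have "norm G \<le> norm (E - transpose (transpose Y ** \<Delta>))"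
    by (rule norm_matrix_mono)
  also have "\<dots> \<le> \<beta> + norm (transpose Y ** \<Delta>)"
    by (rule order_trans[OF norm_triangle_ineq4]) (simp add: norm_transpose E_def \<beta>_def)
  also have "\<dots> \<le> q + sqrt 2 * (sqrt 2 * q)"
  proof (intro add_mono \<beta>q)
    have "norm (transpose Y ** \<Delta>) \<le> sqrt (1 + \<beta>) * norm \<Delta>"
      unfolding \<beta>_def by (rule norm_transpose_matrix_gram_le)
    also have "\<dots> \<le> sqrt 2 * (sqrt 2 * q)"
      using \<beta>1 \<beta>0 q0 by (intro mult_mono \<delta>) auto
    finally show "norm (transpose Y ** \<Delta>) \<le> sqrt 2 * (sqrt 2 * q)" .
  qed
  finally have g: "norm G \<le> 3 * q" by (simp add: mult.assoc[symmetric])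
  have PG: "coordinate_projection C ** G = G"
  proof -
    have "(coordinate_projection C ** G) $ i $ j = (\<Sum>k\<in>UNIV. if k = i then G $ i $ j else 0)" for i j
      unfolding matrix_matrix_mult_def
      by (simp only: vec_lambda_beta, intro sum.cong refl) (auto simp: coordinate_projection_def G0)
    then show ?thesis by (simp add: vec_eq_iff)
  qed
  have WA: "transpose W ** A = 0"
  proof -
    have "transpose W ** A = G - transpose W ** (W ** G)"
      unfolding A_def by (subst (2) G_def)
        (simp add: vec_eq_iff matrix_matrix_mult_def right_diff_distrib sum_subtractf)
    then show ?thesis by (simp only: matrix_mul_assoc W(3) PG) simp
  qed
  have WG: "(norm (W *v (G *v x)))\<^sup>2 = (norm (G *v x))\<^sup>2" for x
  proof -
    have "(norm (W *v (G *v x)))\<^sup>2 = (G *v x) \<bullet> (transpose W *v (W *v (G *v x)))"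
      by (metis inner_transpose_matrix_vector inner_commute power2_norm_eq_inner)
    also have "transpose W *v (W *v (G *v x)) = (coordinate_projection C ** G) *v x"
      by (simp only: matrix_vector_mul_assoc W(3) matrix_mul_assoc)
    finally show ?thesis by (simp only: PG power2_norm_eq_inner)
  qed
  define T where "T = {v :: real^'r. \<forall>j\<in>C. v $ j = 0}"
  define U where "U = {u. transpose W *v u = 0}"
  have sT: "subspace T" by (auto simp: T_def subspace_def)
  have sU: "subspace U"
    unfolding U_def by (rule linear_subspace_kernel[OF matrix_vector_mul_linear])
  have dim: "dim T \<le> dim U"
  proof -
    have "column j W = 0" if "j \<notin> C" for j using that W(2) by (simp add: column_def vec_eq_iff)
    from dim_orthogonal_to_columns[of C W, OF this] show ?thesis
      unfolding T_def U_def dim_vanishing_coordinates using card by linarith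
  qed
  have AT: "A $ i \<in> T" for i
    by (auto simp: T_def A_def YF_def matrix_matrix_mult_def G0)
  have AU: "A *v x \<in> U" for x
    by (simp only: U_def mem_Collect_eq matrix_vector_mul_assoc WA) simp
  obtain B V where B: "finite B" "orthonormal_family id B" "B \<subseteq> T"
    and V: "\<And>i. V $ i \<in> T" "\<And>x. V *v x \<in> U" "\<And>x y. x \<in> T \<Longrightarrow> y \<in> T \<Longrightarrow> (V *v x) \<bullet> (V *v y) = x \<bullet> y"
    and AV: "(norm (A - V))\<^sup>2 \<le> (\<Sum>b\<in>B. \<bar>(norm (A *v b))\<^sup>2 - 1\<bar>)"
    using nearby_partial_isometry[OF sT sU dim AT AU] by metis
  have nb: "norm b = 1" if "b \<in> B" for b
    using B(2) that by (auto simp: orthonormal_family_def norm_eq_1)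
  have stretch: "\<bar>(norm (A *v b))\<^sup>2 - 1\<bar> \<le> norm (E *v b) + (norm (G *v b))\<^sup>2" if b: "b \<in> B" for b
  proof -
    have "Y *v b = YF *v b"
      using B(3) b by (auto simp: vec_eq_iff matrix_vector_mult_def YF_def T_def intro!: sum.cong)
    also have "\<dots> = A *v b + W *v (G *v b)"
      by (simp add: A_def matrix_vector_mult_diff_rdistrib matrix_vector_mul_assoc)
    finally have Yb: "Y *v b = A *v b + W *v (G *v b)" .
    have "(A *v b) \<bullet> (W *v (G *v b)) = (transpose W *v (A *v b)) \<bullet> (G *v b)"
      by (rule inner_transpose_matrix_vector[symmetric])
    also have "\<dots> = 0" by (simp only: matrix_vector_mul_assoc WA) simp
    finally have "(norm (Y *v b))\<^sup>2 = (norm (A *v b))\<^sup>2 + (norm (G *v b))\<^sup>2"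
      by (simp add: Yb dot_norm WG[symmetric])
    moreover have "(norm (Y *v b))\<^sup>2 = 1 + b \<bullet> (E *v b)"
      using norm_sq_matrix_vector_gram[of Y b] nb[OF b] by (simp add: E_def)
    moreover have "\<bar>b \<bullet> (E *v b)\<bar> \<le> norm (E *v b)"
      using Cauchy_Schwarz_ineq2[of b "E *v b"] nb[OF b] by simp
    ultimately show ?thesis by (smt (verit) zero_le_power2)
  qed
  \<comment> \<open>The identity matrix acts isometrically on \<open>B\<close>, and its squared Frobenius norm is \<open>r\<close>.\<close>
  have "real (card B) = (\<Sum>b\<in>B. (norm ((mat 1 :: real^'r^'r) *v b))\<^sup>2)"
    using nb by simp
  also have "\<dots> \<le> (norm (mat 1 :: real^'r^'r))\<^sup>2" by (rule sum_norm_orthonormal_le[OF B(1,2)])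
  also have "\<dots> = (\<Sum>i\<in>(UNIV :: 'r set). \<Sum>j\<in>(UNIV :: 'r set). if i = j then 1 else 0)"
    unfolding norm_matrix_entries by (intro sum.cong) (auto simp: mat_def)
  also have "\<dots> = real CARD('r)" by simp
  finally have cB: "real (card B) \<le> real CARD('r)" .
  have "(\<Sum>b\<in>B. norm (E *v b)) \<le> sqrt (real (card B)) * sqrt (\<Sum>b\<in>B. (norm (E *v b))\<^sup>2)"
    using L2_set_mult_ineq[of "\<lambda>b. 1" "\<lambda>b. norm (E *v b)" B] by (simp add: L2_set_def)
  also have "\<dots> \<le> sqrt (real CARD('r)) * sqrt ((norm E)\<^sup>2)"
    using cB sum_norm_orthonormal_le[OF B(1,2), of E]
    by (intro mult_mono real_sqrt_le_mono) (auto simp: sum_nonneg)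
  finally have sE: "(\<Sum>b\<in>B. norm (E *v b)) \<le> q\<^sup>2" using rq by (simp add: E_def \<beta>_def)
  have sG: "(\<Sum>b\<in>B. (norm (G *v b))\<^sup>2) \<le> 9 * q\<^sup>2"
    using order_trans[OF sum_norm_orthonormal_le[OF B(1,2), of G] power_mono[OF g norm_ge_zero, of 2]]
    by (simp add: power_mult_distrib)
  have "(norm (A - V))\<^sup>2 \<le> (\<Sum>b\<in>B. norm (E *v b) + (norm (G *v b))\<^sup>2)"
    by (rule order_trans[OF AV sum_mono[OF stretch]])
  also have "\<dots> \<le> (sqrt 10 * q)\<^sup>2" using sE sG by (simp add: sum.distrib power_mult_distrib)
  finally have nAV: "norm (A - V) \<le> sqrt 10 * q"
    by (rule power2_le_imp_le) (simp add: q0)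
  have "(norm (W ** G))\<^sup>2 = (norm G)\<^sup>2"
  proof -
    have "column j (W ** G) = W *v (G *v axis j 1)" "column j G = G *v axis j 1" for j
      by (simp_all add: column_matrix_matrix_mult matrix_vector_mult_basis)
    then show ?thesis by (simp only: norm_matrix_columns WG)
  qed
  then have nWG: "norm (W ** G) \<le> 3 * q" using g by simp
  define Z where "Z = W + V"
  \<comment> \<open>The three errors: rounding, projection off \<open>W\<close>, and orthonormalisation.\<close>
  have "Y - Z = \<Delta> + W ** G + (A - V)" by (simp add: Z_def \<Delta>_def A_def)
  then have "norm (Y - Z) \<le> norm \<Delta> + norm (W ** G) + norm (A - V)"
    using norm_triangle_ineq[of "\<Delta> + W ** G" "A - V"] norm_triangle_ineq[of \<Delta> "W ** G"] by simp
  also have "\<dots> \<le> sqrt 2 * q + 3 * q + sqrt 10 * q" by (intro add_mono \<delta> nWG nAV)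
  also have "\<dots> \<le> (3/2) * q + 3 * q + (7/2) * q"
    using q0 by (intro add_mono mult_right_mono real_le_lsqrt) (auto simp: power2_eq_square)
  finally have nZ: "norm (Y - Z) \<le> 8 * q" by simp
  have WV: "transpose W ** V = 0"
  proof -
    have "transpose W *v (V *v x) = 0" for x using V(2)[of x] by (simp only: U_def mem_Collect_eq)
    then have "(transpose W ** V) *v x = 0 *v x" for x by (simp only: matrix_vector_mul_assoc) simp
    then show ?thesis by (simp only: matrix_eq) simp
  qed
  have V0: "V $ i $ j = 0" if "j \<in> C" for i j using V(1)[of i] that by (auto simp: T_def)
  have VV: "(transpose V ** V) $ j $ k = (if j = k \<and> j \<notin> C then 1 else 0)" for j k
  proof (cases "j \<in> C \<or> k \<in> C")
    case True
    then show ?thesis by (auto simp: gram_entry V0)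
  next
    case False
    then have "axis j 1 \<in> T" "axis k 1 \<in> T" by (auto simp: T_def axis_def)
    from V(3)[OF this] have "column j V \<bullet> column k V = (if j = k then 1 else 0)"
      by (simp only: matrix_vector_mult_basis inner_axis_axis) simp
    then show ?thesis using False by (simp add: gram_entry inner_vec_def column_def)
  qed
  have "transpose Z ** Z = transpose W ** W + transpose W ** V + transpose (transpose W ** V) + transpose V ** V"
    by (simp add: vec_eq_iff Z_def matrix_matrix_mult_def transpose_def algebra_simps sum.distrib)
  also have "\<dots> = mat 1"
  proof -
    have "transpose (0 :: real^'r^'r) = 0" by (simp add: vec_eq_iff transpose_def)
    then show ?thesis
      by (simp only: WV W(3)) (simp add: vec_eq_iff VV coordinate_projection_def mat_def)
  qed
  finally have ZZ: "transpose Z ** Z = mat 1" .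
  show ?thesis
    by (rule that[of Z, OF _ ZZ nZ[unfolded q_def]]) (use W(1) V0 in \<open>simp add: Z_def\<close>)
qed

section \<open>The error bound\<close>

text \<open>
  Away from the manifold it is enough to compare norms: the squared norm of \<open>X\<close> is the trace of its
  Gram matrix, hence differs from \<open>r\<close> by at most \<open>sqrt r\<close> times the Gram defect.
\<close>

lemma crude_distance_bound:
  fixes X Z :: "real^'r^'n"
  assumes "transpose Z ** Z = mat 1"
  shows "norm (X - Z) \<le> 2 * sqrt (real CARD('r))
    + sqrt (sqrt (real CARD('r))) * sqrt (norm (transpose X ** X - mat 1))"
proof -
  have frob: "(norm M)\<^sup>2 = (\<Sum>j\<in>UNIV. (transpose M ** M) $ j $ j)" for M :: "real^'r^'n"
    unfolding norm_matrix_entries by (subst sum.swap) (simp add: gram_entry power2_eq_square)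
  let ?E = "transpose X ** X - mat 1"
  have "(norm Z)\<^sup>2 = real CARD('r)" unfolding frob assms by (simp add: mat_def)
  then have nZ: "norm Z = sqrt (real CARD('r))" by (metis norm_ge_zero real_sqrt_unique)
  have "(norm X)\<^sup>2 = (\<Sum>j\<in>UNIV. 1 + ?E $ j $ j)" unfolding frob by (simp add: mat_def)
  also have "\<dots> = real CARD('r) + (\<Sum>j\<in>UNIV. ?E $ j $ j)" by (simp add: sum.distrib)
  also have "(\<Sum>j\<in>UNIV. ?E $ j $ j) \<le> (\<Sum>j\<in>UNIV. norm (?E $ j))"
    by (intro sum_mono) (metis abs_le_D1 component_le_norm_cart)
  also have "\<dots> \<le> sqrt (real CARD('r)) * norm ?E" by (rule sum_norm_component_le)
  finally have "sqrt ((norm X)\<^sup>2) \<le> sqrt (real CARD('r) + sqrt (real CARD('r)) * norm ?E)"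
    by (intro real_sqrt_le_mono) simp
  also have "\<dots> \<le> sqrt (real CARD('r)) + sqrt (sqrt (real CARD('r)) * norm ?E)"
    by (rule sqrt_add_le_add_sqrt) auto
  finally show ?thesis
    using norm_triangle_ineq4[of X Z] by (simp add: nZ real_sqrt_mult)
qed

text \<open>
  Truncation to \<open>Y = X + D\<close> raises the Gram defect to at most \<open>(8/3) (a + b)\<close>, and the hypothesis
  \<open>a + b < 1 / (3 sqrt r)\<close> keeps \<open>sqrt r\<close> times this below \<open>8/9\<close>, so that \<open>nearby_sign_frame\<close> applies to
  \<open>Y\<close>. Its error is \<open>8 sqrt (r \<beta>)\<close>, and \<open>8 sqrt (8/3) < 14\<close>; the truncation itself accounts for the
  remaining unit in the constant 15.
\<close>

proposition local_error_bound:
  fixes X :: "real^'r^'n" and C :: "'r set"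
  defines "a \<equiv> norm (\<chi> i j. if j \<in> C then max (- X $ i $ j) 0 else 0 :: real^'r^'n)"
    and "b \<equiv> norm (transpose X ** X - mat 1)"
  assumes card: "CARD('r) \<le> CARD('n)" and small: "a + b < 1 / (3 * sqrt (real CARD('r)))"
  obtains Z :: "real^'r^'n" where
    "\<And>i j. j \<in> C \<Longrightarrow> Z $ i $ j \<ge> 0" "transpose Z ** Z = mat 1"
    "norm (X - Z) \<le> 15 * sqrt (real CARD('r)) * (sqrt a + sqrt b)"
proof -
  define R where "R = sqrt (real CARD('r))"
  have R1: "1 \<le> R" by (simp add: R_def Suc_leI)
  have RR: "R * R = real CARD('r)" by (simp add: R_def)
  define D :: "real^'r^'n" where "D = (\<chi> i j. if j \<in> C then max (- X $ i $ j) 0 else 0)"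
  have D: "norm D = a" by (simp add: D_def a_def)
  have a0: "a \<ge> 0" and b0: "b \<ge> 0" by (auto simp: a_def b_def)
  have "1 / (3 * R) \<le> 1 / 3" using R1 by (simp add: field_simps)
  then have ab: "a + b < 1 / 3" using small unfolding R_def by linarith
  define Y where "Y = X + D"
  define \<beta> where "\<beta> = norm (transpose Y ** Y - mat 1)"
  have "\<beta> \<le> b + 2 * sqrt (1 + b) * a + a\<^sup>2"
    unfolding \<beta>_def Y_def b_def D[symmetric] by (rule gram_perturbation)
  also have "\<dots> \<le> b + 2 * (7/6) * a + a * (1/3)"
  proof -
    have "sqrt (1 + b) \<le> 7/6"
      by (rule real_le_lsqrt) (use ab a0 b0 in \<open>auto simp: power2_eq_square\<close>)
    then have "sqrt (1 + b) * a \<le> (7/6) * a" using a0 by (rule mult_right_mono)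
    moreover have "a * a \<le> a * (1/3)" using ab a0 b0 by (intro mult_left_mono) auto
    ultimately show ?thesis by (simp add: power2_eq_square)
  qed
  also have "\<dots> \<le> (8/3) * (a + b)" using a0 b0 by simp
  finally have \<beta>: "\<beta> \<le> (8/3) * (a + b)" .
  have "R * (a + b) < 1/3" using small R1 by (simp add: R_def[symmetric] field_simps)
  moreover have "R * \<beta> \<le> R * ((8/3) * (a + b))" using R1 by (intro mult_left_mono \<beta>) auto
  ultimately have "R * \<beta> < 1" by (simp add: algebra_simps)
  moreover have "Y $ i $ j \<ge> 0" if "j \<in> C" for i j using that by (simp add: Y_def D_def)
  ultimately obtain Z :: "real^'r^'n" where Z: "\<And>i j. j \<in> C \<Longrightarrow> Z $ i $ j \<ge> 0" "transpose Z ** Z = mat 1"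
    "norm (Y - Z) \<le> 8 * sqrt (real CARD('r) * \<beta>)"
    using nearby_sign_frame[OF card, of C Y] unfolding R_def \<beta>_def by blast
  have "sqrt (8/3) \<le> (7/4 :: real)" by (rule real_le_lsqrt) (auto simp: power2_eq_square)
  have "sqrt \<beta> \<le> sqrt (8/3) * sqrt (a + b)"
    using \<beta> by (simp add: real_sqrt_mult[symmetric])
  also have "\<dots> \<le> (7/4) * (sqrt a + sqrt b)"
    using a0 b0 by (intro mult_mono sqrt_add_le_add_sqrt \<open>sqrt (8/3) \<le> 7/4\<close>) auto
  finally have "R * sqrt \<beta> \<le> R * ((7/4) * (sqrt a + sqrt b))" using R1 by (intro mult_left_mono) auto
  then have "norm (Y - Z) \<le> 14 * R * (sqrt a + sqrt b)"
    using Z(3) by (simp add: real_sqrt_mult R_def[symmetric] algebra_simps)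
  moreover have "norm (X - Z) \<le> norm (Y - Z) + a"
    using norm_triangle_ineq4[of "Y - Z" D] by (simp add: Y_def D)
  moreover have "a \<le> R * (sqrt a + sqrt b)"
  proof -
    have "a * a \<le> 1 * a" using a0 b0 ab by (intro mult_right_mono) auto
    then have "a \<le> sqrt a" by (intro real_le_rsqrt) (simp add: power2_eq_square)
    also have "\<dots> \<le> sqrt a + sqrt b" using b0 by simp
    also have "\<dots> \<le> R * (sqrt a + sqrt b)" using mult_right_mono[OF R1, of "sqrt a + sqrt b"] a0 b0 by simp
    finally show ?thesis .
  qed
  ultimately have "norm (X - Z) \<le> 15 * sqrt (real CARD('r)) * (sqrt a + sqrt b)"
    by (simp add: R_def[symmetric])
  from that[OF Z(1,2) this] show ?thesis .
qed

text \<open>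
  Flipping the sign of the columns in \<open>N\<close> is an isometry that preserves the Gram defect and turns all
  sign constraints into nonnegativity.
\<close>

definition flip_columns :: "'r set \<Rightarrow> real^'r^'n \<Rightarrow> real^'r^'n" where
  "flip_columns N X = (\<chi> i j. (if j \<in> N then - 1 else 1) * X $ i $ j)"

lemma norm_flip_columns: "norm (flip_columns N X) = norm X"
  by (intro antisym norm_matrix_mono) (auto simp: flip_columns_def)

lemma flip_columns_flip_columns: "flip_columns N (flip_columns N X) = X"
  by (simp add: vec_eq_iff flip_columns_def)

lemma flip_columns_diff: "flip_columns N (X - Y) = flip_columns N X - flip_columns N Y"
  by (simp add: vec_eq_iff flip_columns_def algebra_simps)

lemma gram_flip_columns_entry:
  fixes X :: "real^'r^'n"
  shows "(transpose (flip_columns N X) ** flip_columns N X) $ j $ k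
    = (if j \<in> N then - 1 else 1) * (if k \<in> N then - 1 else 1) * (transpose X ** X) $ j $ k"
  by (simp add: gram_entry flip_columns_def sum_distrib_left sum_negf mult_ac)

lemma norm_gram_flip_columns:
  fixes X :: "real^'r^'n"
  shows "norm (transpose (flip_columns N X) ** flip_columns N X - mat 1)
    = norm (transpose X ** X - mat 1)"
  by (intro antisym norm_matrix_mono) (auto simp: gram_flip_columns_entry mat_def)

theorem theorem9:
  fixes P N :: "'r::finite set"
    and S X :: "real^'r^'n::finite"
  assumes "CARD('r) \<le> CARD('n)"
    and "P \<inter> N = {}"
    and "S = sign_matrix P N"
  shows "infdist X (sign_stiefel S)
           \<le> 15 * real CARD('r) powr (3/4)
              * (sqrt (norm (neg_part (hadamard S X))) + sqrt (norm (transpose X ** X - mat 1)))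
       \<and> (norm (neg_part (hadamard S X)) + norm (transpose X ** X - mat 1)
             < 1 / (3 * sqrt (real CARD('r)))
          \<longrightarrow> infdist X (sign_stiefel S)
           \<le> 15 * sqrt (real CARD('r))
              * (sqrt (norm (neg_part (hadamard S X))) + sqrt (norm (transpose X ** X - mat 1))))"
proof -
  define a where "a = norm (neg_part (hadamard S X))"
  define b where "b = norm (transpose X ** X - mat 1)"
  define d where "d = infdist X (sign_stiefel S)"
  define r where "r = real CARD('r)"
  define s where "s = sqrt a + sqrt b"
  have r1: "r \<ge> 1" by (simp add: r_def Suc_leI)
  have a0: "a \<ge> 0" and b0: "b \<ge> 0" by (auto simp: a_def b_def)
  have s0: "s \<ge> 0" using a0 b0 by (simp add: s_def)
  define F where "F = flip_columns N X"
  have "(\<chi> i j. if j \<in> P \<union> N then max (- F $ i $ j) 0 else 0) = neg_part (hadamard S X)"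
    using assms(2) by (auto simp: vec_eq_iff F_def flip_columns_def neg_part_def hadamard_def
        assms(3) sign_matrix_def)
  then have Fa: "norm (\<chi> i j. if j \<in> P \<union> N then max (- F $ i $ j) 0 else 0 :: real^'r^'n) = a"
    by (simp only: a_def)
  have Fb: "norm (transpose F ** F - mat 1) = b"
    by (simp add: F_def b_def norm_gram_flip_columns)
  have near: "d \<le> 15 * sqrt r * s" if small: "a + b < 1 / (3 * sqrt r)"
  proof -
    obtain Z :: "real^'r^'n" where Z: "\<And>i j. j \<in> P \<union> N \<Longrightarrow> Z $ i $ j \<ge> 0" "transpose Z ** Z = mat 1"
      "norm (F - Z) \<le> 15 * sqrt r * s"
      using local_error_bound[where X = F and C = "P \<union> N", OF assms(1)] small unfolding Fa Fb r_def s_def by blast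
    have "hadamard S (flip_columns N Z) \<ge> 0"
      using Z(1) assms(2) by (auto simp: matrix_le_iff hadamard_def assms(3) sign_matrix_def flip_columns_def)
    moreover have "transpose (flip_columns N Z) ** flip_columns N Z = mat 1"
      using norm_gram_flip_columns[of N Z] Z(2) by simp
    ultimately have "flip_columns N Z \<in> sign_stiefel S" by (simp add: sign_stiefel_def)
    then have "d \<le> norm (X - flip_columns N Z)"
      unfolding d_def dist_norm[symmetric] by (rule infdist_le)
    also have "\<dots> = norm (F - Z)"
      by (metis F_def flip_columns_diff flip_columns_flip_columns norm_flip_columns)
    finally show ?thesis using Z(3) by simp
  qed
  have r34: "sqrt r * sqrt (sqrt r) = r powr (3/4)"
    using r1 by (simp add: powr_half_sqrt[symmetric] powr_powr powr_add[symmetric])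
  have rr: "1 \<le> sqrt (sqrt r)" using r1 by simp
  have "d \<le> 15 * r powr (3/4) * s"
  proof (cases "a + b < 1 / (3 * sqrt r)")
    case True
    have "15 * sqrt r * s \<le> 15 * (sqrt r * sqrt (sqrt r)) * s"
      using s0 rr r1 by (intro mult_right_mono mult_left_mono) auto
    then show ?thesis using near[OF True] r34 by simp
  next
    case False
    obtain Z where Z: "Z \<in> sign_stiefel S"
      using sign_stiefel_nonempty[OF assms(1,2)] assms(3) by blast
    then have "d \<le> norm (X - Z)" unfolding d_def dist_norm[symmetric] by (rule infdist_le)
    also have "\<dots> \<le> 2 * sqrt r + sqrt (sqrt r) * sqrt b"
      using crude_distance_bound[of Z X] Z by (simp add: sign_stiefel_def r_def b_def)
    finally have d: "d \<le> 2 * sqrt r + sqrt (sqrt r) * sqrt b" .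
    \<comment> \<open>Far from the manifold \<open>s\<close> is at least of order \<open>r powr (- 1/4)\<close>, so \<open>r powr (3/4) * s\<close> dominates \<open>sqrt r\<close>.\<close>
    have "1 \<le> 3 * sqrt r * (a + b)" using False r1 by (simp add: field_simps)
    then have "1 \<le> sqrt (3 * sqrt r * (a + b))" by simp
    also have "\<dots> = sqrt 3 * sqrt (sqrt r) * sqrt (a + b)" by (simp add: real_sqrt_mult)
    also have "\<dots> \<le> 2 * sqrt (sqrt r) * s"
      unfolding s_def using a0 b0 r1
      by (intro mult_mono sqrt_add_le_add_sqrt real_le_lsqrt) (auto simp: power2_eq_square)
    finally have "sqrt r * 1 \<le> sqrt r * (2 * sqrt (sqrt r) * s)" using r1 by (intro mult_left_mono) auto
    then have 1: "sqrt r \<le> 2 * (r powr (3/4) * s)" by (simp add: r34[symmetric] mult_ac)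
    have "1 * (sqrt (sqrt r) * sqrt b) \<le> sqrt r * (sqrt (sqrt r) * s)"
      using r1 a0 b0 s0 by (intro mult_mono mult_left_mono) (auto simp: s_def)
    then have 2: "sqrt (sqrt r) * sqrt b \<le> r powr (3/4) * s" by (simp add: r34[symmetric] mult_ac)
    have "0 \<le> r powr (3/4) * s" using s0 by simp
    then show ?thesis using d 1 2 by simp
  qed
  then show ?thesis using near unfolding a_def b_def d_def r_def s_def by blast
qed

end
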